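(* For any integers $k \geq 2$ and $t \geq 2$, there is a constant $\beta_k$, depending only on $k$, such that for all $n$, \[ \mathrm{ex}(n, C_{2k+1}, K_{2,t}\text{-ind}) \leq ( \alpha ( k , t )^{1/2} + 1 )^{1/2} \frac{ n^{3/2} }{2} + \beta_k n^{1 + 1/(2k)}, \] where $\alpha (k,t) = ( 2k -2)(t - 1)( ( 2k -2)(t - 1) - 1)$.
   Context: For graphs $H$ and $F$, $\mathrm{ex}(n, H, F\text{-ind})$ denotes the maximum number of edges in an $n$-vertex graph that contains no (not necessarily induced) subgraph isomorphic to $H$ and no induced subgraph isomorphic to $F$. $C_{2k+1}$ is the cycle of length $2k+1$. *)

theory Defs
  imports Complex_Main "Graph_Theory.Graph_Theory"
begin

text \<open>
  Finite simple graphs are the \<open>pair_graph\<close>s of Graph_Theory: finite, loop-free digraphs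
  with a symmetric arc relation, so each undirected edge is a pair of opposite arcs. \<open>subgraph\<close>,
  \<open>induced_subgraph\<close> and \<open>digraph_iso\<close> are the library notions. A subgraph in the
  library sense need not be symmetric, but one isomorphic to a simple graph is.
\<close>

definition edge_set :: "'a pair_pre_digraph \<Rightarrow> 'a set set" where
  "edge_set G = (\<lambda>(u, v). {u, v}) ` parcs G"

definition contains_subgraph :: "'a pair_pre_digraph \<Rightarrow> 'b pair_pre_digraph \<Rightarrow> bool" where
  "contains_subgraph G H \<longleftrightarrow>
     (\<exists>S. subgraph S (with_proj G) \<and> digraph_iso S (with_proj H))"

definition contains_induced_subgraph :: "'a pair_pre_digraph \<Rightarrow> 'b pair_pre_digraph \<Rightarrow> bool" where
  "contains_induced_subgraph G F \<longleftrightarrow>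
     (\<exists>S. induced_subgraph S (with_proj G) \<and> digraph_iso S (with_proj F))"

text \<open>
  Every finite graph is isomorphic to one with vertices in \<open>nat\<close>, so that vertex type is no
  restriction. The set below is always finite, and it contains the edge number 0 of the empty
  graph whenever \<open>H\<close> and \<open>F\<close> have an edge; see \<open>finite_ex_ind_set\<close> and
  \<open>ex_ind_set_nonempty\<close>.
\<close>

definition ex_ind_set :: "nat \<Rightarrow> 'a pair_pre_digraph \<Rightarrow> 'b pair_pre_digraph \<Rightarrow> nat set" where
  "ex_ind_set n H F =
     {card (edge_set G) | G :: nat pair_pre_digraph.
        pair_graph G \<and> card (pverts G) = n \<and>
        \<not> contains_subgraph G H \<and> \<not> contains_induced_subgraph G F}"

definition ex_ind :: "nat \<Rightarrow> 'a pair_pre_digraph \<Rightarrow> 'b pair_pre_digraph \<Rightarrow> nat" where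
  "ex_ind n H F = Max (ex_ind_set n H F)"

text \<open>The cycle of length \<open>m\<close>; a simple graph for \<open>m \<ge> 3\<close>.\<close>

definition cycle_graph :: "nat \<Rightarrow> nat pair_pre_digraph" where
  "cycle_graph m =
     \<lparr>pverts = {..<m},
      parcs = {(i, j). i < m \<and> j < m \<and> (j = Suc i mod m \<or> i = Suc j mod m)}\<rparr>"

definition complete_bipartite_graph :: "nat \<Rightarrow> nat \<Rightarrow> (nat + nat) pair_pre_digraph" where
  "complete_bipartite_graph s t =
     (let U = Inl ` {..<s}; V = Inr ` {..<t}
      in \<lparr>pverts = U \<union> V, parcs = U \<times> V \<union> V \<times> U\<rparr>)"

definition alpha :: "nat \<Rightarrow> nat \<Rightarrow> real" where
  "alpha k t =
     (2 * real k - 2) * (real t - 1) * ((2 * real k - 2) * (real t - 1) - 1)"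


lemma finite_ex_ind_set: "finite (ex_ind_set n H F)"
proof (rule finite_subset)
  show "ex_ind_set n H F \<subseteq> {..n * n}"
  proof
    fix e assume "e \<in> ex_ind_set n H F"
    then obtain G :: "nat pair_pre_digraph"
      where G: "pair_graph G" "card (pverts G) = n" "e = card (edge_set G)"
      unfolding ex_ind_set_def by blast
    interpret pair_graph G by fact
    have "e \<le> card (parcs G)"
      unfolding G(3) edge_set_def by (rule card_image_le) simp
    also have "\<dots> \<le> card (pverts G \<times> pverts G)"
      by (rule card_mono) (auto dest: in_arcsD1 in_arcsD2)
    finally show "e \<in> {..n * n}" by (simp add: G(2) card_cartesian_product)
  qed
qed simp

lemma iso_has_arcs:
  assumes "digraph_iso S (with_proj K)" "parcs K \<noteq> {}"
  shows "arcs S \<noteq> {}"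
proof -
  obtain f where "with_proj K = app_iso f S"
    using assms(1) unfolding digraph_iso_def by blast
  then have "arcs (with_proj K) = iso_arcs f ` arcs S" by (simp only: arcs_app_iso)
  with assms(2) show ?thesis by auto
qed

lemma ex_ind_set_nonempty:
  assumes "parcs H \<noteq> {}" "parcs F \<noteq> {}"
  shows "0 \<in> ex_ind_set n H F"
proof -
  define G :: "nat pair_pre_digraph" where "G = \<lparr>pverts = {..<n}, parcs = {}\<rparr>"
  have 1: "pair_graph G"
    by unfold_locales (auto simp: G_def symmetric_def)
  have 2: "\<not> contains_subgraph G H"
    using iso_has_arcs[OF _ assms(1)] unfolding contains_subgraph_def by (fastforce simp: subgraph_def G_def)
  have 3: "\<not> contains_induced_subgraph G F"
    using iso_has_arcs[OF _ assms(2)] unfolding contains_induced_subgraph_def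
    by (fastforce simp: induced_subgraph_def subgraph_def G_def)
  have "0 = card (edge_set G) \<and> pair_graph G \<and> card (pverts G) = n \<and>
      \<not> contains_subgraph G H \<and> \<not> contains_induced_subgraph G F"
    using 1 2 3 by (simp add: edge_set_def G_def)
  then show ?thesis unfolding ex_ind_set_def by blast
qed

lemma pair_graph_cycle_graph:
  assumes "m \<ge> 3" shows "pair_graph (cycle_graph m)"
proof unfold_locales
  fix e assume e: "e \<in> parcs (cycle_graph m)"
  show "fst e \<in> pverts (cycle_graph m)" "snd e \<in> pverts (cycle_graph m)"
    using e by (auto simp: cycle_graph_def)
  show "fst e \<noteq> snd e"
    using e assms by (auto simp: cycle_graph_def mod_Suc split: if_splits)
next
  have "parcs (cycle_graph m) \<subseteq> {..<m} \<times> {..<m}" by (auto simp: cycle_graph_def)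
  then show "finite (parcs (cycle_graph m))" by (rule finite_subset) simp
qed (auto simp: cycle_graph_def symmetric_def sym_def)

lemma complete_bipartite_graph_is_complete_bipartite:
  "K\<^bsub>s,t\<^esub> (with_proj (complete_bipartite_graph s t))"
proof -
  let ?U = "Inl ` {..<s} :: (nat + nat) set" and ?V = "Inr ` {..<t} :: (nat + nat) set"
  have "?U \<inter> ?V = {}" "card ?U = s" "card ?V = t"
    by (auto simp: card_image)
  then show ?thesis
    unfolding complete_bipartite_digraph_pair_def complete_bipartite_graph_def Let_def
    by (intro conjI exI[of _ ?U] exI[of _ ?V]) simp_all
qed

end

theory Submission
  imports Defs "HOL-Analysis.Convex"
begin

text \<open>
  Put \<open>c = (2k - 2)(t - 1)\<close> and let \<open>M\<close> be the number of arcs. If \<open>u \<noteq> v\<close> and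
  \<open>p\<^sub>1, \<dots>, p\<^sub>2\<^sub>k\<^sub>-\<^sub>1\<close> is a path in their common neighbourhood, then
  \<open>u, p\<^sub>1, \<dots>, p\<^sub>2\<^sub>k\<^sub>-\<^sub>2, v, p\<^sub>2\<^sub>k\<^sub>-\<^sub>1\<close> is a \<open>C\<^sub>2\<^sub>k\<^sub>+\<^sub>1\<close>. So the common neighbourhood is
  \<open>(2k - 3)\<close>-degenerate and a \<open>1/(2k - 2)\<close> fraction of it is independent; if \<open>u, v\<close> are not
  adjacent, it has at most \<open>c\<close> vertices. Likewise a single neighbourhood has no path on
  \<open>2k\<close> vertices, so the number of triangles is linear in \<open>M\<close>, and adjacent pairs only
  contribute to lower order. Counting paths of length two gives
  \<open>\<Sum> d(w)\<^sup>2 \<le> c n\<^sup>2 + 4 k M\<close>, and Cauchy-Schwarz yields \<open>M \<le> sqrt c n\<^sup>3\<^sup>/\<^sup>2 + 4 k n\<close>. This is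
  stronger than claimed, since \<open>c \<le> sqrt (c (c - 1)) + 1\<close>.
\<close>

section \<open>Embedded copies of a graph from vertex maps\<close>

text \<open>Serves as the witness \<open>S\<close> in both containment notions, so that exhibiting a
  copy of \<open>H\<close> reduces to giving an injective vertex map.\<close>

definition image_graph :: "('b \<Rightarrow> 'a) \<Rightarrow> 'b pair_pre_digraph \<Rightarrow> 'a pair_pre_digraph" where
  "image_graph f H = \<lparr>pverts = f ` pverts H, parcs = map_prod f f ` parcs H\<rparr>"

lemma pair_wf_digraph_image_graph:
  assumes "pair_wf_digraph H"
  shows "pair_wf_digraph (image_graph f H)"
proof -
  interpret H: pair_wf_digraph H by fact
  show ?thesis
    by unfold_locales (auto simp: image_graph_def dest: H.in_arcsD1 H.in_arcsD2)
qed

lemma digraph_iso_image_graph: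
  assumes "pair_wf_digraph H" "inj_on f (pverts H)"
  shows "digraph_iso (with_proj (image_graph f H)) (with_proj H)"
proof -
  interpret H: pair_wf_digraph H by fact
  \<comment> \<open>Arcs are pairs, so the vertex map alone dictates the arc map, and the
    projections are the new tail and head.\<close>
  define h where "h = \<lparr>iso_verts = f, iso_arcs = map_prod f f, iso_head = snd, iso_tail = fst\<rparr>"
  have "inj_on (map_prod f f) (pverts H \<times> pverts H)"
    using assms(2) by (auto simp: inj_on_def)
  then have "inj_on (map_prod f f) (parcs H)"
    by (rule inj_on_subset) (auto dest: H.in_arcsD1 H.in_arcsD2)
  then have "pre_digraph.digraph_isomorphism (with_proj H) h"
    using assms by (auto simp: pre_digraph.digraph_isomorphism_def wf_digraph_wp_iff h_def)
  moreover have "with_proj (image_graph f H) = app_iso h (with_proj H)"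
    by (simp add: image_graph_def h_def app_iso_def with_proj_def)
  ultimately have "digraph_iso (with_proj H) (with_proj (image_graph f H))"
    unfolding digraph_iso_def by blast
  then show ?thesis
    using assms(1) by (simp add: digraph_iso_swap wf_digraph_wp_iff)
qed

lemma subgraph_image_graph:
  assumes "pair_wf_digraph G" "pair_wf_digraph H" "f ` pverts H \<subseteq> pverts G"
    and "\<And>u v. (u, v) \<in> parcs H \<Longrightarrow> (f u, f v) \<in> parcs G"
  shows "subgraph (with_proj (image_graph f H)) (with_proj G)"
proof -
  have "pair_wf_digraph (image_graph f H)" using assms(2) by (rule pair_wf_digraph_image_graph)
  moreover have "parcs (image_graph f H) \<subseteq> parcs G" using assms(4) by (auto simp: image_graph_def)
  ultimately show ?thesis
    using assms(1,3) by (auto simp: subgraph_def wf_digraph_wp_iff image_graph_def)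
qed

lemma contains_subgraphI:
  assumes "pair_wf_digraph G" "pair_wf_digraph H"
    and "inj_on f (pverts H)" "f ` pverts H \<subseteq> pverts G"
    and "\<And>u v. (u, v) \<in> parcs H \<Longrightarrow> (f u, f v) \<in> parcs G"
  shows "contains_subgraph G H"
  unfolding contains_subgraph_def
  using subgraph_image_graph[OF assms(1,2,4,5)] digraph_iso_image_graph[OF assms(2,3)] by blast

lemma contains_induced_subgraphI:
  assumes "pair_wf_digraph G" "pair_wf_digraph H"
    and "inj_on f (pverts H)" "f ` pverts H \<subseteq> pverts G"
    and arcs: "\<And>u v. u \<in> pverts H \<Longrightarrow> v \<in> pverts H \<Longrightarrow> (f u, f v) \<in> parcs G \<longleftrightarrow> (u, v) \<in> parcs H"
  shows "contains_induced_subgraph G H"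
proof -
  interpret H: pair_wf_digraph H by fact
  have arc: "(f u, f v) \<in> parcs G" if "(u, v) \<in> parcs H" for u v
    using that arcs H.in_arcsD1[OF that] H.in_arcsD2[OF that] by simp
  have "induced_subgraph (with_proj (image_graph f H)) (with_proj G)"
    using subgraph_image_graph[OF assms(1,2,4) arc] arc arcs
    by (auto simp: induced_subgraph_def image_graph_def dest: H.in_arcsD1 H.in_arcsD2)
  then show ?thesis
    using digraph_iso_image_graph[OF assms(2,3)] unfolding contains_induced_subgraph_def by blast
qed

section \<open>Adjacency as a relation and the degree sum\<close>

lemma pair_graph_sym:
  assumes "pair_graph G"
  shows "sym (parcs G)"
proof -
  interpret pair_graph G by fact
  show ?thesis using pair_sym_arcs by (simp add: symmetric_def)
qed

lemma pair_graph_irrefl: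
  assumes "pair_graph G"
  shows "irrefl (parcs G)"
proof -
  interpret pair_graph G by fact
  show ?thesis using pair_no_loops by (fastforce simp: irrefl_def)
qed

text \<open>Each arc is counted once, at its tail; an edge is two arcs, which absorbs the usual
  factor 2 of the handshake identity.\<close>

lemma sum_card_neighbourhoods:
  assumes "pair_graph G"
  shows "(\<Sum>w\<in>pverts G. card (parcs G `` {w})) = card (parcs G)"
proof -
  interpret pair_graph G by fact
  have "card (parcs G) = card (SIGMA w:pverts G. parcs G `` {w})"
    by (rule arg_cong[of _ _ card]) (auto dest: in_arcsD1)
  also have "\<dots> = (\<Sum>w\<in>pverts G. card (parcs G `` {w}))"
    by (rule card_SigmaI) (auto intro: finite_subset[of _ "pverts G"] dest: in_arcsD2)
  finally show ?thesis by simp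
qed

section \<open>Recognising odd cycles, induced complete bipartite graphs and edges\<close>

text \<open>The embedding is \<open>nth xs\<close>: arcs of \<open>cycle_graph\<close> join
  consecutive indices modulo the length, and the wrap-around is the closing arc.\<close>

lemma contains_cycle_graphI:
  assumes "pair_graph G" "distinct xs" "length xs \<ge> 3" "set xs \<subseteq> pverts G"
    and path: "successively (\<lambda>x y. (x, y) \<in> parcs G) xs" and close: "(last xs, hd xs) \<in> parcs G"
  shows "contains_subgraph G (cycle_graph (length xs))"
proof -
  interpret G: pair_graph G by fact
  interpret C: pair_graph "cycle_graph (length xs)" using assms(3) by (rule pair_graph_cycle_graph)
  have nonempty: "xs \<noteq> []" using assms(3) by auto
  have step: "(xs ! i, xs ! (Suc i mod length xs)) \<in> parcs G" if "i < length xs" for i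
  proof (cases "Suc i < length xs")
    case True
    then show ?thesis using path by (simp add: successively_conv_nth)
  next
    case False
    with that have "i = length xs - 1" "Suc i mod length xs = 0" by (auto simp: mod_Suc)
    then show ?thesis using close nonempty by (simp add: last_conv_nth hd_conv_nth)
  qed
  show ?thesis
  proof (rule contains_subgraphI)
    show "inj_on (nth xs) (pverts (cycle_graph (length xs)))"
      using assms(2) by (auto simp: cycle_graph_def inj_on_def nth_eq_iff_index_eq)
    show "nth xs ` pverts (cycle_graph (length xs)) \<subseteq> pverts G"
      using assms(4) by (auto simp: cycle_graph_def)
    show "(xs ! u, xs ! v) \<in> parcs G" if "(u, v) \<in> parcs (cycle_graph (length xs))" for u v
      using that step[of u] step[of v] pair_graph_sym[OF assms(1)]
      by (auto simp: cycle_graph_def dest: symD)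
  qed unfold_locales
qed

text \<open>Any \<open>t\<close> vertices of \<open>I\<close> form one side and \<open>u\<close>,
  \<open>v\<close> the other. The copy is induced because neither side spans an arc.\<close>

lemma contains_induced_complete_bipartite_graphI:
  assumes "pair_graph G" "u \<in> pverts G" "v \<in> pverts G" "u \<noteq> v" "(u, v) \<notin> parcs G"
    and I: "I \<subseteq> parcs G `` {u} \<inter> parcs G `` {v}" "card I \<ge> t"
    and indep: "\<And>x y. x \<in> I \<Longrightarrow> y \<in> I \<Longrightarrow> (x, y) \<notin> parcs G"
  shows "contains_induced_subgraph G (complete_bipartite_graph 2 t)"
proof -
  interpret G: pair_graph G by fact
  have sym: "sym (parcs G)" using assms(1) by (rule pair_graph_sym)
  have loop: "(x, x) \<notin> parcs G" for x using G.pair_no_loops by fastforce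
  obtain J where J: "J \<subseteq> I" "card J = t" "finite J"
    using obtain_subset_with_card_n[OF I(2)] by blast
  then obtain g where g: "bij_betw g {..<t} J"
    using ex_bij_betw_nat_finite[OF J(3)] by (auto simp: atLeast0LessThan)
  define f where "f = case_sum (\<lambda>i::nat. if i = 0 then u else v) g"
  have gI: "g i \<in> I" if "i < t" for i
    using g J(1) that by (auto simp: bij_betw_def)
  have nbr: "(u, g i) \<in> parcs G" "(v, g i) \<in> parcs G" "(g i, u) \<in> parcs G" "(g i, v) \<in> parcs G"
    if "i < t" for i
    using gI[OF that] I(1) sym by (auto dest: symD)
  have non: "(g i, g j) \<notin> parcs G" if "i < t" "j < t" for i j
    using that indep gI by blast
  have ne: "g i \<noteq> u" "g i \<noteq> v" if "i < t" for i
    using nbr[OF that] loop by auto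
  have two: "i < 2 \<longleftrightarrow> i = 0 \<or> i = 1" for i :: nat by auto
  show ?thesis
  proof (rule contains_induced_subgraphI)
    show "pair_wf_digraph (complete_bipartite_graph 2 t)"
      by unfold_locales (auto simp: complete_bipartite_graph_def)
    show "inj_on f (pverts (complete_bipartite_graph 2 t))"
      using g assms(4) ne ne[symmetric]
      by (auto simp: complete_bipartite_graph_def f_def inj_on_def bij_betw_def two)
    show "f ` pverts (complete_bipartite_graph 2 t) \<subseteq> pverts G"
      using assms(2,3) G.in_arcsD2[OF nbr(1)]
      by (auto simp: complete_bipartite_graph_def f_def)
    show "(f a, f b) \<in> parcs G \<longleftrightarrow> (a, b) \<in> parcs (complete_bipartite_graph 2 t)"
      if "a \<in> pverts (complete_bipartite_graph 2 t)" "b \<in> pverts (complete_bipartite_graph 2 t)"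
      for a b
      using that assms(5) symD[OF sym, of v u] loop nbr non
      by (auto simp: complete_bipartite_graph_def f_def two)
  qed unfold_locales
qed

text \<open>Every edge lies under two opposite arcs, distinct since there are no loops; the
  incidences of arcs and edges are counted twice.\<close>

lemma card_edge_set:
  assumes "pair_graph G"
  shows "2 * card (edge_set G) \<le> card (parcs G)"
proof -
  interpret G: pair_graph G by fact
  have fin: "finite (parcs G)" by simp
  have two: "2 \<le> card {a \<in> parcs G. (\<lambda>(u, v). {u, v}) a = e}" if e: "e \<in> edge_set G" for e
  proof -
    obtain u v where uv: "(u, v) \<in> parcs G" "e = {u, v}"
      using e by (auto simp: edge_set_def)
    then have "(v, u) \<in> parcs G" "u \<noteq> v"
      using pair_graph_sym[OF assms] G.pair_no_loops[OF uv(1)] by (auto dest: symD)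
    then have "{(u, v), (v, u)} \<subseteq> {a \<in> parcs G. (\<lambda>(u, v). {u, v}) a = e}"
      using uv by auto
    then have "card {(u, v), (v, u)} \<le> card {a \<in> parcs G. (\<lambda>(u, v). {u, v}) a = e}"
      by (rule card_mono[rotated]) (use fin in simp)
    then show ?thesis using \<open>u \<noteq> v\<close> by simp
  qed
  have "2 * card (edge_set G) \<le> (\<Sum>e\<in>edge_set G. card {a \<in> parcs G. (\<lambda>(u, v). {u, v}) a = e})"
    using sum_bounded_below[of "edge_set G" 2, OF two] by (simp add: mult.commute)
  also have "\<dots> = (\<Sum>a\<in>parcs G. 1)"
  proof (rule sum_multicount_gen)
    show "finite (edge_set G)" using fin by (simp add: edge_set_def)
    show "\<forall>a\<in>parcs G. card {e \<in> edge_set G. (\<lambda>(u, v). {u, v}) a = e} = 1"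
    proof
      fix a assume "a \<in> parcs G"
      then have "{e \<in> edge_set G. (\<lambda>(u, v). {u, v}) a = e} = {(\<lambda>(u, v). {u, v}) a}"
        by (auto simp: edge_set_def)
      then show "card {e \<in> edge_set G. (\<lambda>(u, v). {u, v}) a = e} = 1" by simp
    qed
  qed (fact fin)
  finally show ?thesis by simp
qed

section \<open>Long paths and degenerate graphs\<close>

text \<open>A path on at most \<open>m\<close> vertices can be extended at its head, since the rest
  of the path is too small to contain all neighbours of the head.\<close>

lemma min_degree_path:
  assumes "sym E" "irrefl E" "finite S" "S \<noteq> {}"
    and deg: "\<And>x. x \<in> S \<Longrightarrow> m \<le> card (E `` {x} \<inter> S)"
  shows "\<exists>p. length p = Suc m \<and> distinct p \<and> set p \<subseteq> S \<and> successively (\<lambda>x y. (x, y) \<in> E) p"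
proof -
  have "\<exists>p. length p = Suc j \<and> distinct p \<and> set p \<subseteq> S \<and> successively (\<lambda>x y. (x, y) \<in> E) p"
    if "j \<le> m" for j
    using that
  proof (induction j)
    case 0
    obtain x where "x \<in> S" using assms(4) by blast
    then show ?case by (intro exI[of _ "[x]"]) simp
  next
    case (Suc j)
    then obtain p where p: "length p = Suc j" "distinct p" "set p \<subseteq> S"
      "successively (\<lambda>x y. (x, y) \<in> E) p" by auto
    then obtain x q where q: "p = x # q" by (cases p) auto
    \<comment> \<open>The head \<open>x\<close> is not its own neighbour, so only the
      \<open>j < m\<close> vertices of \<open>q\<close> are excluded. This is what yields
      \<open>Suc m\<close> vertices rather than \<open>m\<close>.\<close>
    have "card (set q) < card (E `` {x} \<inter> S)"
      using p(1,2,3) q deg[of x] Suc.prems by (auto simp: distinct_card)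
    then have "\<not> E `` {x} \<inter> S \<subseteq> set q"
      using card_mono[of "set q" "E `` {x} \<inter> S"] by auto
    then obtain y where y: "(x, y) \<in> E" "y \<in> S" "y \<notin> set q" by blast
    have "y \<noteq> x" using y(1) assms(2) by (auto simp: irrefl_def)
    then show ?case
      using p q y assms(1) by (intro exI[of _ "y # p"]) (auto dest: symD)
  qed
  then show ?thesis by blast
qed

text \<open>Greedy choice: put a vertex of degree below \<open>m\<close> into \<open>I\<close>,
  delete it with its neighbours, and repeat. Each chosen vertex costs at most \<open>m\<close>
  vertices of \<open>S\<close>.\<close>

lemma degenerate_independent_set:
  assumes "sym E" "irrefl E" "finite S"
    and "\<And>T. T \<subseteq> S \<Longrightarrow> T \<noteq> {} \<Longrightarrow> \<exists>x\<in>T. card (E `` {x} \<inter> T) < m"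
  shows "\<exists>I\<subseteq>S. card S \<le> m * card I \<and> (\<forall>x\<in>I. \<forall>y\<in>I. (x, y) \<notin> E)"
  using assms(3,4)
proof (induction S rule: finite_psubset_induct)
  case (psubset S)
  show ?case
  proof (cases "S = {}")
    case False
    then obtain x where x: "x \<in> S" "card (E `` {x} \<inter> S) < m" using psubset.prems[of S] by auto
    define T where "T = S - insert x (E `` {x})"
    have "T \<subset> S" using x(1) by (auto simp: T_def)
    then have "\<exists>I\<subseteq>T. card T \<le> m * card I \<and> (\<forall>x\<in>I. \<forall>y\<in>I. (x, y) \<notin> E)"
      by (rule psubset.IH) (meson \<open>T \<subset> S\<close> psubset.prems subset_psubset_trans psubset_imp_subset)
    then obtain I where I: "I \<subseteq> T" "card T \<le> m * card I" "\<forall>x\<in>I. \<forall>y\<in>I. (x, y) \<notin> E"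
      by blast
    have "finite T" using psubset.hyps by (simp add: T_def)
    then have finI: "finite I" using I(1) by (rule rev_finite_subset)
    have xI: "x \<notin> I" using I(1) by (auto simp: T_def)
    have "S = T \<union> insert x (E `` {x} \<inter> S)" using x(1) by (auto simp: T_def)
    then have "card S \<le> card T + card (insert x (E `` {x} \<inter> S))" by (metis card_Un_le)
    also have "card (insert x (E `` {x} \<inter> S)) \<le> m"
      using x(2) psubset.hyps by (simp add: card_insert_if)
    finally have "card S \<le> m * card (insert x I)"
      using I(2) finI xI by simp
    moreover have "\<forall>a\<in>insert x I. \<forall>b\<in>insert x I. (a, b) \<notin> E"
      using I(1,3) assms(1,2) by (auto simp: T_def irrefl_def dest: symD)
    moreover have "insert x I \<subseteq> S" using I(1) x(1) by (auto simp: T_def)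
    ultimately show ?thesis by blast
  qed auto
qed

text \<open>Deleting a vertex of degree below \<open>m\<close> destroys at most \<open>m\<close>
  arcs in each direction, hence the factor 2.\<close>

lemma degenerate_card_arcs:
  assumes "sym E" "finite S"
    and "\<And>T. T \<subseteq> S \<Longrightarrow> T \<noteq> {} \<Longrightarrow> \<exists>x\<in>T. card (E `` {x} \<inter> T) < m"
  shows "card (E \<inter> S \<times> S) \<le> 2 * m * card S"
  using assms(2,3)
proof (induction S rule: finite_psubset_induct)
  case (psubset S)
  show ?case
  proof (cases "S = {}")
    case False
    then obtain x where x: "x \<in> S" "card (E `` {x} \<inter> S) < m" using psubset.prems[of S] by auto
    let ?T = "S - {x}" and ?N = "E `` {x} \<inter> S"
    have "?T \<subset> S" using x(1) by auto
    then have IH: "card (E \<inter> ?T \<times> ?T) \<le> 2 * m * card ?T"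
      by (rule psubset.IH) (meson \<open>?T \<subset> S\<close> psubset.prems subset_psubset_trans psubset_imp_subset)
    have "E \<inter> S \<times> S \<subseteq> E \<inter> ?T \<times> ?T \<union> ({x} \<times> ?N \<union> ?N \<times> {x})"
      using assms(1) by (auto dest: symD)
    then have "card (E \<inter> S \<times> S) \<le> card (E \<inter> ?T \<times> ?T \<union> ({x} \<times> ?N \<union> ?N \<times> {x}))"
      by (rule card_mono[rotated]) (use psubset.hyps in simp)
    also have "\<dots> \<le> card (E \<inter> ?T \<times> ?T) + (card ({x} \<times> ?N) + card (?N \<times> {x}))"
      by (intro order_trans[OF card_Un_le] add_left_mono card_Un_le)
    also have "\<dots> \<le> 2 * m * card ?T + 2 * m"
      using IH x(2) by (simp add: card_cartesian_product)
    also have "\<dots> = 2 * m * card S"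
      using x(1) psubset.hyps by (metis card_Suc_Diff1 mult_Suc_right add.commute)
    finally show ?thesis .
  qed auto
qed

section \<open>Neighbourhoods in graphs without the odd cycle\<close>

text \<open>Otherwise \<open>T\<close> has minimum degree at least \<open>2 * k - 1\<close>, hence
  contains a path on \<open>2 * k\<close> vertices, which \<open>w\<close> closes to a forbidden
  cycle.\<close>

lemma neighbourhood_degenerate:
  assumes "pair_graph G" "k \<ge> 2" "\<not> contains_subgraph G (cycle_graph (2 * k + 1))"
    and T: "T \<subseteq> parcs G `` {w}" "T \<noteq> {}"
  shows "\<exists>x\<in>T. card (parcs G `` {x} \<inter> T) < 2 * k - 1"
proof (rule ccontr)
  assume neg: "\<not> ?thesis"
  interpret G: pair_graph G by fact
  have sym: "sym (parcs G)" using assms(1) by (rule pair_graph_sym)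
  have irr: "irrefl (parcs G)" using assms(1) by (rule pair_graph_irrefl)
  have TV: "T \<subseteq> pverts G" using T(1) by (auto dest: G.in_arcsD2)
  then have "finite T" by (rule finite_subset) simp
  then obtain p where p: "length p = Suc (2 * k - 1)" "distinct p" "set p \<subseteq> T"
    "successively (\<lambda>x y. (x, y) \<in> parcs G) p"
    using min_degree_path[OF sym irr _ T(2), of "2 * k - 1"] neg by (meson linorder_not_less)
  have len: "length (w # p) = 2 * k + 1" using p(1) assms(2) by simp
  have ne: "p \<noteq> []" using p(1) by auto
  have nbr: "(w, x) \<in> parcs G" "(x, w) \<in> parcs G" if "x \<in> set p" for x
    using that p(3) T(1) sym by (auto dest: symD)
  have "contains_subgraph G (cycle_graph (length (w # p)))"
  proof (rule contains_cycle_graphI)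
    show "distinct (w # p)" using p(2) nbr irr by (auto simp: irrefl_def)
    show "set (w # p) \<subseteq> pverts G"
      using p(3) TV nbr(1)[OF hd_in_set[OF ne]] by (auto dest: G.in_arcsD1)
    show "successively (\<lambda>x y. (x, y) \<in> parcs G) (w # p)"
      using p(4) ne nbr by (simp add: successively_Cons)
    show "(last (w # p), hd (w # p)) \<in> parcs G" using ne nbr by simp
  qed (use assms(1,2) len in simp_all)
  with assms(3) len show False by simp
qed

text \<open>Here a path on \<open>2 * k - 1\<close> vertices is enough, because both
  \<open>u\<close> and \<open>v\<close> can be inserted into it. This saves one in the degree
  compared with a single neighbourhood.\<close>

lemma common_neighbourhood_degenerate:
  assumes "pair_graph G" "k \<ge> 2" "\<not> contains_subgraph G (cycle_graph (2 * k + 1))"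
    and "u \<noteq> v" and T: "T \<subseteq> parcs G `` {u} \<inter> parcs G `` {v}" "T \<noteq> {}"
  shows "\<exists>x\<in>T. card (parcs G `` {x} \<inter> T) < 2 * k - 2"
proof (rule ccontr)
  assume neg: "\<not> ?thesis"
  interpret G: pair_graph G by fact
  have sym: "sym (parcs G)" using assms(1) by (rule pair_graph_sym)
  have irr: "irrefl (parcs G)" using assms(1) by (rule pair_graph_irrefl)
  have TV: "T \<subseteq> pverts G" using T(1) by (auto dest: G.in_arcsD2)
  then have "finite T" by (rule finite_subset) simp
  then obtain p where p: "length p = Suc (2 * k - 2)" "distinct p" "set p \<subseteq> T"
    "successively (\<lambda>x y. (x, y) \<in> parcs G) p"
    using min_degree_path[OF sym irr _ T(2), of "2 * k - 2"] neg by (meson linorder_not_less)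
  obtain q w where q: "p = q @ [w]" using p(1) by (cases p rule: rev_cases) auto
  \<comment> \<open>In the cycle below, \<open>q\<close> and \<open>w\<close> must separate
    \<open>u\<close> from \<open>v\<close>, which need not be adjacent; for \<open>q\<close> this
    uses \<open>k \<ge> 2\<close>.\<close>
  have ne: "q \<noteq> []" using p(1) q assms(2) by auto
  let ?c = "u # q @ [v, w]"
  have len: "length ?c = 2 * k + 1" using p(1) q assms(2) by simp
  have nbr: "(u, x) \<in> parcs G" "(x, u) \<in> parcs G" "(v, x) \<in> parcs G" "(x, v) \<in> parcs G"
    if "x \<in> set p" for x
    using that p(3) T(1) sym by (auto dest: symD)
  have nmem: "u \<notin> set p" "v \<notin> set p" using nbr irr unfolding irrefl_def by blast+
  have w: "w \<in> set p" and hd: "hd q \<in> set p" and last: "last q \<in> set p" using q ne by auto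
  have "contains_subgraph G (cycle_graph (length ?c))"
  proof (rule contains_cycle_graphI)
    show "distinct ?c" using p(2) nmem assms(4) by (auto simp: q)
    show "set ?c \<subseteq> pverts G"
      using p(3) TV nbr[OF w] by (auto simp: q dest: G.in_arcsD1)
    show "successively (\<lambda>x y. (x, y) \<in> parcs G) ?c"
      using p(4) ne nbr[OF w] nbr[OF hd] nbr[OF last]
      by (simp add: q successively_Cons successively_append_iff)
    show "(last ?c, hd ?c) \<in> parcs G" using nbr[OF w] by simp
  qed (use assms(1,2) len in simp_all)
  with assms(3) len show False by simp
qed

text \<open>Degeneracy gives an independent set containing at least a \<open>1 / (2 * k - 2)\<close>
  fraction of the common neighbourhood; with \<open>t\<close> vertices it would form an induced copy
  of the bipartite graph together with \<open>u\<close> and \<open>v\<close>.\<close>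

lemma card_common_neighbourhood:
  assumes "pair_graph G" "k \<ge> 2" "\<not> contains_subgraph G (cycle_graph (2 * k + 1))"
    and "\<not> contains_induced_subgraph G (complete_bipartite_graph 2 t)"
    and "u \<in> pverts G" "v \<in> pverts G" "u \<noteq> v" "(u, v) \<notin> parcs G"
  shows "card (parcs G `` {u} \<inter> parcs G `` {v}) \<le> (2 * k - 2) * (t - 1)"
proof -
  interpret G: pair_graph G by fact
  let ?N = "parcs G `` {u} \<inter> parcs G `` {v}"
  have sym: "sym (parcs G)" using assms(1) by (rule pair_graph_sym)
  have irr: "irrefl (parcs G)" using assms(1) by (rule pair_graph_irrefl)
  have fin: "finite ?N" by (rule finite_subset[of _ "pverts G"]) (auto dest: G.in_arcsD2)
  have "\<exists>I\<subseteq>?N. card ?N \<le> (2 * k - 2) * card I \<and> (\<forall>x\<in>I. \<forall>y\<in>I. (x, y) \<notin> parcs G)"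
    using sym irr fin common_neighbourhood_degenerate[OF assms(1-3,7)]
    by (rule degenerate_independent_set)
  then obtain I where I: "I \<subseteq> ?N" "card ?N \<le> (2 * k - 2) * card I"
    "\<forall>x\<in>I. \<forall>y\<in>I. (x, y) \<notin> parcs G"
    by blast
  have "card I < t"
    using contains_induced_complete_bipartite_graphI[OF assms(1,5-8) I(1)] I(3) assms(4)
    by (meson linorder_not_less)
  then have "(2 * k - 2) * card I \<le> (2 * k - 2) * (t - 1)" by (intro mult_left_mono) auto
  with I(2) show ?thesis by linarith
qed

section \<open>Counting paths of length two\<close>

text \<open>The left side counts triples of a vertex and an ordered pair of its neighbours.
  Regrouped by pairs, distinct non-adjacent pairs give the quadratic term, while adjacent pairs
  (triangles) and equal pairs (degrees) are linear in the number of arcs.\<close>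

lemma sum_card_neighbourhood_squares:
  assumes "pair_graph G" "k \<ge> 2" "\<not> contains_subgraph G (cycle_graph (2 * k + 1))"
    and "\<not> contains_induced_subgraph G (complete_bipartite_graph 2 t)"
  shows "(\<Sum>w\<in>pverts G. (card (parcs G `` {w}))\<^sup>2)
    \<le> (2 * k - 2) * (t - 1) * (card (pverts G))\<^sup>2 + 4 * k * card (parcs G)"
proof -
  interpret G: pair_graph G by fact
  let ?E = "parcs G" and ?V = "pverts G" and ?c = "(2 * k - 2) * (t - 1)"
  let ?R = "\<lambda>w p. (w, fst p) \<in> ?E \<and> (w, snd p) \<in> ?E"
  let ?cd = "\<lambda>p. card {w \<in> ?V. ?R w p}"
  have sym: "sym ?E" using assms(1) by (rule pair_graph_sym)
  have nbrs: "?E `` {w} \<subseteq> ?V" for w by (auto dest: G.in_arcsD2)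
  have finN: "finite (?E `` {w})" for w using nbrs by (rule finite_subset) simp
  have cd: "{w \<in> ?V. ?R w p} = ?E `` {fst p} \<inter> ?E `` {snd p}" for p
    using sym by (auto dest: symD G.in_arcsD1)
  have deg: "(\<Sum>w\<in>?V. card (?E `` {w})) = card ?E"
    using assms(1) by (rule sum_card_neighbourhoods)
  have triangles: "(\<Sum>p\<in>?E. ?cd p) \<le> 2 * (2 * k - 1) * card ?E"
  proof -
    \<comment> \<open>Triangles are regrouped by apex \<open>w\<close>: the opposite arc lies in the
      neighbourhood of \<open>w\<close>, which is degenerate and so spans linearly many
      arcs.\<close>
    have "(\<Sum>p\<in>?E. ?cd p) = (\<Sum>w\<in>?V. card {p \<in> ?E. ?R w p})"
      by (rule sum_multicount_gen[symmetric]) auto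
    also have "\<dots> \<le> (\<Sum>w\<in>?V. 2 * (2 * k - 1) * card (?E `` {w}))"
    proof (rule sum_mono)
      fix w
      have "{p \<in> ?E. ?R w p} = ?E \<inter> ?E `` {w} \<times> ?E `` {w}" by auto
      then show "card {p \<in> ?E. ?R w p} \<le> 2 * (2 * k - 1) * card (?E `` {w})"
        using degenerate_card_arcs[OF sym finN neighbourhood_degenerate[OF assms(1-3)]] by simp
    qed
    also have "\<dots> = 2 * (2 * k - 1) * card ?E" by (simp flip: sum_distrib_left add: deg)
    finally show ?thesis .
  qed
  have "(\<Sum>w\<in>?V. (card (?E `` {w}))\<^sup>2) = (\<Sum>w\<in>?V. card {p \<in> ?V \<times> ?V. ?R w p})"
  proof (rule sum.cong)
    fix w
    have "{p \<in> ?V \<times> ?V. ?R w p} = ?E `` {w} \<times> ?E `` {w}" using nbrs by auto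
    then show "(card (?E `` {w}))\<^sup>2 = card {p \<in> ?V \<times> ?V. ?R w p}"
      by (simp add: card_cartesian_product power2_eq_square)
  qed simp
  also have "\<dots> = (\<Sum>p\<in>?V \<times> ?V. ?cd p)"
    by (rule sum_multicount_gen) auto
  \<comment> \<open>The bound \<open>?c\<close> is granted to every pair, and adjacent or equal
    pairs receive their true count on top, so the sum separates into three.\<close>
  also have "\<dots> \<le> (\<Sum>p\<in>?V \<times> ?V. ?c + (if p \<in> ?E then ?cd p else 0)
      + (if p \<in> Id then ?cd p else 0))"
  proof (rule sum_mono)
    fix p assume "p \<in> ?V \<times> ?V"
    then show "?cd p \<le> ?c + (if p \<in> ?E then ?cd p else 0) + (if p \<in> Id then ?cd p else 0)"
      using card_common_neighbourhood[OF assms, of "fst p" "snd p"] unfolding cd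
      by (cases p) auto
  qed
  also have "\<dots> = ?c * (card ?V)\<^sup>2 + (\<Sum>p\<in>?V \<times> ?V \<inter> ?E. ?cd p) + (\<Sum>p\<in>?V \<times> ?V \<inter> Id. ?cd p)"
    by (simp add: sum.distrib sum.inter_restrict card_cartesian_product power2_eq_square)
  also have "?V \<times> ?V \<inter> ?E = ?E" by (auto dest: G.in_arcsD1 G.in_arcsD2)
  also have "(\<Sum>p\<in>?V \<times> ?V \<inter> Id. ?cd p) = card ?E"
  proof -
    have "?V \<times> ?V \<inter> Id = (\<lambda>w. (w, w)) ` ?V" by auto
    then show ?thesis unfolding cd by (simp add: sum.reindex inj_on_def deg)
  qed
  also have "?c * (card ?V)\<^sup>2 + (\<Sum>p\<in>?E. ?cd p) + card ?E
      \<le> ?c * (card ?V)\<^sup>2 + 2 * (2 * k - 1) * card ?E + card ?E"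
    using triangles by simp
  also have "\<dots> = ?c * (card ?V)\<^sup>2 + (2 * (2 * k - 1) + 1) * card ?E" by simp
  \<comment> \<open>The exact coefficient is \<open>4 * k - 1\<close>: twice
    \<open>2 * k - 1\<close> from triangles plus one from equal pairs.\<close>
  also have "\<dots> \<le> ?c * (card ?V)\<^sup>2 + 4 * k * card ?E"
    using assms(2) by (intro add_left_mono mult_right_mono) auto
  finally show ?thesis .
qed

section \<open>From the degree squares to the edge bound\<close>

text \<open>If \<open>M > A + B\<close>, then \<open>M\<close> and \<open>M - B\<close> both exceed
  \<open>A\<close>, so their product exceeds the square of \<open>A\<close>.\<close>

lemma square_le_imp_le:
  fixes M A B :: real
  assumes "M\<^sup>2 \<le> A\<^sup>2 + B * M" "0 \<le> A" "0 \<le> B"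
  shows "M \<le> A + B"
proof (rule ccontr)
  assume "\<not> ?thesis"
  then have "A * A < M * (M - B)"
    using assms(2,3) by (intro mult_strict_mono') auto
  with assms(1) show False by (simp add: power2_eq_square algebra_simps)
qed

lemma card_arcs_bound:
  assumes "pair_graph G" "k \<ge> 2" "t \<ge> 2" "\<not> contains_subgraph G (cycle_graph (2 * k + 1))"
    and "\<not> contains_induced_subgraph G (complete_bipartite_graph 2 t)"
    and n: "card (pverts G) = n"
  shows "real (card (parcs G))
    \<le> sqrt ((2 * real k - 2) * (real t - 1)) * real n powr (3/2) + 4 * real k * real n"
proof -
  let ?E = "parcs G" and ?V = "pverts G"
  define c where "c = (2 * real k - 2) * (real t - 1)"
  define M where "M = real (card ?E)"
  \<comment> \<open>Chosen so that its square is \<open>c * real n ^ 3\<close>, the main term after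
    Cauchy-Schwarz.\<close>
  define A where "A = sqrt c * real n powr (3/2)"
  have c: "real ((2 * k - 2) * (t - 1)) = c" "c \<ge> 0"
    using assms(2,3) by (auto simp: c_def of_nat_diff)
  have "M = (\<Sum>w\<in>?V. real (card (?E `` {w})))"
    using sum_card_neighbourhoods[OF assms(1)] by (simp add: M_def flip: of_nat_sum)
  then have "M\<^sup>2 \<le> (\<Sum>w\<in>?V. (real (card (?E `` {w})))\<^sup>2) * real n"
    using sum_squared_le_sum_of_squares[of "\<lambda>w. real (card (?E `` {w}))" ?V] n by simp
  also have "(\<Sum>w\<in>?V. (real (card (?E `` {w})))\<^sup>2) \<le> c * (real n)\<^sup>2 + 4 * real k * M"
  proof -
    have "(\<Sum>w\<in>?V. (card (?E `` {w}))\<^sup>2) \<le> (2 * k - 2) * (t - 1) * n\<^sup>2 + 4 * k * card ?E"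
      using sum_card_neighbourhood_squares[OF assms(1,2,4,5)] unfolding n .
    then have "real (\<Sum>w\<in>?V. (card (?E `` {w}))\<^sup>2) \<le> real ((2 * k - 2) * (t - 1) * n\<^sup>2 + 4 * k * card ?E)"
      by (rule of_nat_mono)
    then show ?thesis
      using c(1) by (simp only: of_nat_add of_nat_mult of_nat_power of_nat_sum of_nat_numeral M_def)
  qed
  finally have "M\<^sup>2 \<le> c * real n ^ 3 + 4 * real k * real n * M"
    by (simp add: mult_right_mono algebra_simps power2_eq_square power3_eq_cube)
  also have "c * real n ^ 3 = A\<^sup>2"
  proof -
    have "(real n powr (3/2))\<^sup>2 = real n ^ 3"
      by (cases "n = 0") (simp_all add: powr_power powr_numeral)
    then show ?thesis using c(2) by (simp add: A_def power_mult_distrib)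
  qed
  finally have "M \<le> A + 4 * real k * real n"
    by (rule square_le_imp_le) (use c(2) in \<open>auto simp: A_def\<close>)
  then show ?thesis by (simp add: M_def A_def c_def)
qed

text \<open>With \<open>c \<ge> 1\<close> the product below \<open>alpha\<close> is
  \<open>c * (c - 1)\<close>, at least the square of \<open>c - 1\<close>; taking roots gives
  \<open>c - 1 \<le> sqrt (alpha k t)\<close>.\<close>

lemma sqrt_le_alpha:
  assumes "k \<ge> 2" "t \<ge> 2"
  shows "sqrt ((2 * real k - 2) * (real t - 1)) \<le> (alpha k t powr (1/2) + 1) powr (1/2)"
proof -
  define c where "c = (2 * real k - 2) * (real t - 1)"
  have "1 * 1 \<le> (2 * real k - 2) * (real t - 1)"
    using assms by (intro mult_mono) auto
  then have c: "c \<ge> 1" by (simp add: c_def)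
  have alpha: "alpha k t = c * (c - 1)" by (simp add: alpha_def c_def)
  have "(c - 1)\<^sup>2 \<le> c * (c - 1)" using c by (simp add: power2_eq_square mult_right_mono)
  then have "c - 1 \<le> sqrt (c * (c - 1))" by (rule real_le_rsqrt)
  moreover have "0 \<le> c * (c - 1)" using c by simp
  ultimately have "c \<le> alpha k t powr (1/2) + 1" by (simp add: alpha powr_half_sqrt)
  then have "sqrt c \<le> sqrt (alpha k t powr (1/2) + 1)" by simp
  then show ?thesis by (simp add: powr_half_sqrt flip: c_def)
qed

theorem theorem4:
  fixes k :: nat
  assumes "k \<ge> 2"
  shows "\<exists>\<beta>::real. \<forall>t::nat. t \<ge> 2 \<longrightarrow> (\<forall>n::nat.
     real (ex_ind n (cycle_graph (2 * k + 1)) (complete_bipartite_graph 2 t))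
       \<le> (alpha k t powr (1/2) + 1) powr (1/2) * (real n powr (3/2) / 2)
         + \<beta> * real n powr (1 + 1 / (2 * real k)))"
\<comment> \<open>Half of the coefficient \<open>4 * real k\<close> in
  \<open>card_arcs_bound\<close>, as an edge is two arcs; it does not involve
  \<open>t\<close>.\<close>
proof (intro exI[of _ "2 * real k"] allI impI)
  fix t n :: nat
  assume t: "t \<ge> 2"
  let ?C = "cycle_graph (2 * k + 1)" and ?K = "complete_bipartite_graph 2 t"
  have "(0, 1) \<in> parcs ?C" using assms by (auto simp: cycle_graph_def)
  moreover have "(Inl 0, Inr 0) \<in> parcs ?K" using t by (auto simp: complete_bipartite_graph_def)
  \<comment> \<open>Nonemptiness makes \<open>Max\<close> an attained value, so an extremal graph
    can be fixed.\<close>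
  ultimately have "ex_ind_set n ?C ?K \<noteq> {}"
    using ex_ind_set_nonempty[of ?C ?K n] by blast
  then have "ex_ind n ?C ?K \<in> ex_ind_set n ?C ?K"
    unfolding ex_ind_def using finite_ex_ind_set by (intro Max_in)
  then obtain G :: "nat pair_pre_digraph" where G: "pair_graph G" "card (pverts G) = n"
    "\<not> contains_subgraph G ?C" "\<not> contains_induced_subgraph G ?K"
    and ex: "ex_ind n ?C ?K = card (edge_set G)"
    unfolding ex_ind_set_def by blast
  have "2 * real (ex_ind n ?C ?K) \<le> real (card (parcs G))"
    using card_edge_set[OF G(1)] unfolding ex by linarith
  also have "\<dots> \<le> sqrt ((2 * real k - 2) * (real t - 1)) * real n powr (3/2) + 4 * real k * real n"
    using G(1) assms t G(3,4,2) by (rule card_arcs_bound)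
  also have "\<dots> \<le> (alpha k t powr (1/2) + 1) powr (1/2) * real n powr (3/2)
      + 4 * real k * real n powr (1 + 1 / (2 * real k))"
  proof (intro add_mono mult_right_mono mult_left_mono sqrt_le_alpha assms t)
    \<comment> \<open>The linear error is absorbed by the larger power. Monotonicity in the exponent
      requires base at least 1, so \<open>n = 0\<close> is treated apart.\<close>
    show "real n \<le> real n powr (1 + 1 / (2 * real k))"
    proof (cases "n = 0")
      case False
      then have "real n powr 1 \<le> real n powr (1 + 1 / (2 * real k))"
        by (intro powr_mono) auto
      then show ?thesis using False by simp
    qed simp
  qed simp_all
  finally show "real (ex_ind n ?C ?K) \<le> (alpha k t powr (1/2) + 1) powr (1/2) * (real n powr (3/2) / 2)
      + 2 * real k * real n powr (1 + 1 / (2 * real k))"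
    by simp
qed

end
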